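(* Let $p$ be a prime, let $K$ and $L$ be $\mathbb{Z}_p$-complexes, and let $(\phi_i)_{i\ge0}$ and $(\phi'_i)_{i\geq0}$ be resolutions of $1$ for $K$ and $L$ respectively. Put $s_q=1+t+\cdots+t^q$. Then a resolution $(\Phi_j)_{j\ge0}$ of $1$ for $K*L$ is defined by $$\Phi_j=\Phi^j_{-1}+\Phi^j_0+\Phi^j_1+\cdots+\Phi^j_j ,\qquad j=0,1,2,\ldots,$$ where: (1) if $j=2m$ is even, $$\Phi^{2m}_{-1}=\emptyset\otimes\phi'_{2m},\qquad \Phi^{2m}_{2l}=\phi_{2l}\otimes t^{-l}\phi'_{2m-2l-1},\qquad \Phi^{2m}_{2l+1}=\phi_{2l+1}\otimes t^{-(l+1)}\phi'_{2m-(2l+1)-1};$$ (2) if $j=2m+1$ is odd, $$\Phi^{2m+1}_{-1}=\emptyset\otimes\phi'_{2m+1},\qquad \Phi^{2m+1}_{2l}=\sum_{q=0}^{p-2}\bigl((s-s_q)\phi_{2l}\bigr)\otimes t^{-l+q}\phi'_{2m+1-2l-1},\qquad \Phi^{2m+1}_{2l+1}=\phi_{2l+1}\otimes t^{-(l+1)}\phi'_{(2m+1)-(2l+1)-1}.$$ Here $l\ge0$ ranges over the values for which the lower index of $\Phi^j_{2l}$, resp. $\Phi^j_{2l+1}$, is at most $j$, and $\phi'_{-1}=\emptyset$.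
   Context: All simplicial complexes are finite and augmented: the empty simplex $\emptyset$ is the unique $(-1)$-dimensional simplex, $\partial v=\emptyset$ for each vertex $v$, and $t(\emptyset)=\emptyset$. $\emptyset$ also denotes the cochain in $C^{-1}$ with value $1$ on the empty simplex. A $\mathbb{Z}_p$-complex is a simplicial complex $K$ with a simplicial automorphism $t$, $t^p=\mathrm{id}$, such that $t^k\sigma\neq\sigma$ for every non-empty simplex $\sigma$ and $k\not\equiv0\pmod p$. $t$ also denotes the induced map on integral simplicial cochains $C^*(K)$; $d=1-t$, $s=1+t+\cdots+t^{p-1}$. A resolution of $1$ for $K$ is a sequence $\phi_j\in C^j(K)$, $j\ge0$, with $s\phi_0=1$ (the cochain with value $1$ on each vertex), $\delta\phi_j=d\phi_{j+1}$ for $j$ even and $\delta\phi_j=s\phi_{j+1}$ for $j$ odd. The join $K*L$ is a $\mathbb{Z}_p$-complex with $t$ acting on the vertices of each factor; simplices of $K*L$ are oriented by listing vertices of $K$ before those of $L$. The cochain group $C^n(K*L)$ is identified with $\bigoplus_{i+j=n-1,\ i,j\geq-1}C^i(K)\otimes C^j(L)$ by $(\eta\otimes\eta')(\sigma*\tau)=\eta(\sigma)\eta'(\tau)$ for $\dim\sigma=i$, $\dim\tau=j$ (zero on other simplices). Under this identification $t(\eta\otimes\eta')=t\eta\otimes t\eta'$ and $\delta(\eta\otimes\eta')=\delta\eta\otimes\eta'+(-1)^{i+1}\eta\otimes\delta\eta'$ for $\eta\in C^i(K)$. *)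

theory Defs
  imports
    "HOL-Computational_Algebra.Primes"
    "HOL-Combinatorics.Permutations"
    "HOL-Library.Function_Algebras"
begin

definition simplicial_complex :: "'a set set \<Rightarrow> bool" where
  "simplicial_complex K \<longleftrightarrow>
     finite K \<and> (\<forall>\<sigma>\<in>K. finite \<sigma>) \<and> {} \<in> K \<and> (\<forall>\<sigma>\<in>K. \<forall>\<tau>. \<tau> \<subseteq> \<sigma> \<longrightarrow> \<tau> \<in> K)"

(* The vertex set is \<Union>K; an automorphism is a permutation of it, extended to the
   ambient type by the identity. *)
definition Zp_complex :: "nat \<Rightarrow> 'a set set \<Rightarrow> ('a \<Rightarrow> 'a) \<Rightarrow> bool" where
  "Zp_complex p K t \<longleftrightarrow>
     simplicial_complex K \<and> t permutes \<Union>K \<and> (\<lambda>\<sigma>. t ` \<sigma>) ` K = K \<and> t ^^ p = id \<and>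
     (\<forall>\<sigma>\<in>K. \<sigma> \<noteq> {} \<longrightarrow> (\<forall>k. \<not> p dvd k \<longrightarrow> (t ^^ k) ` \<sigma> \<noteq> \<sigma>))"

(* An integral n-cochain is a homomorphism to the integers from the group of oriented n-chains,
   that is, an alternating function of the ordered n-simplices (v0, ..., vn), here extended by 0
   to all lists. The only (-1)-simplex is the empty list. *)
definition cochains :: "'a set set \<Rightarrow> int \<Rightarrow> ('a list \<Rightarrow> int) set" where
  "cochains K n =
     {c. (\<forall>xs. c xs \<noteq> 0 \<longrightarrow> distinct xs \<and> set xs \<in> K \<and> int (length xs) = n + 1) \<and>
         (\<forall>xs \<pi>. \<pi> permutes {..<length xs} \<longrightarrow> c (permute_list \<pi> xs) = sign \<pi> * c xs)}"

definition coboundary :: "'a set set \<Rightarrow> ('a list \<Rightarrow> int) \<Rightarrow> 'a list \<Rightarrow> int" where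
  "coboundary K c xs =
     (if distinct xs \<and> set xs \<in> K
      then \<Sum>i<length xs. (-1) ^ i * c (take i xs @ drop (Suc i) xs) else 0)"

definition empty_cochain :: "'a list \<Rightarrow> int" where
  "empty_cochain xs = (if xs = [] then 1 else 0)"

definition one_cochain :: "'a set set \<Rightarrow> 'a list \<Rightarrow> int" where
  "one_cochain K xs = (if \<exists>v. xs = [v] \<and> {v} \<in> K then 1 else 0)"

(* The k-th power of the induced map c \<mapsto> c \<circ> t on cochains, for an integer k. *)
definition tpow :: "('a \<Rightarrow> 'a) \<Rightarrow> int \<Rightarrow> ('a list \<Rightarrow> int) \<Rightarrow> 'a list \<Rightarrow> int" where
  "tpow t k c xs = c (map (if k \<ge> 0 then t ^^ nat k else inv t ^^ nat (- k)) xs)"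

definition dmap :: "('a \<Rightarrow> 'a) \<Rightarrow> ('a list \<Rightarrow> int) \<Rightarrow> 'a list \<Rightarrow> int" where
  "dmap t c = c - tpow t 1 c"

(* 1 + t + ... + t^q *)
definition spart :: "('a \<Rightarrow> 'a) \<Rightarrow> nat \<Rightarrow> ('a list \<Rightarrow> int) \<Rightarrow> 'a list \<Rightarrow> int" where
  "spart t q c = (\<Sum>k=0..q. tpow t (int k) c)"

definition smap :: "nat \<Rightarrow> ('a \<Rightarrow> 'a) \<Rightarrow> ('a list \<Rightarrow> int) \<Rightarrow> 'a list \<Rightarrow> int" where
  "smap p t = spart t (p - 1)"

definition resolution_of_one ::
    "nat \<Rightarrow> 'a set set \<Rightarrow> ('a \<Rightarrow> 'a) \<Rightarrow> (nat \<Rightarrow> 'a list \<Rightarrow> int) \<Rightarrow> bool" where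
  "resolution_of_one p K t \<phi> \<longleftrightarrow>
     (\<forall>j. \<phi> j \<in> cochains K (int j)) \<and>
     smap p t (\<phi> 0) = one_cochain K \<and>
     (\<forall>j. even j \<longrightarrow> coboundary K (\<phi> j) = dmap t (\<phi> (j + 1))) \<and>
     (\<forall>j. odd j \<longrightarrow> coboundary K (\<phi> j) = smap p t (\<phi> (j + 1)))"

definition join :: "'a set set \<Rightarrow> 'b set set \<Rightarrow> ('a + 'b) set set" where
  "join K L = {\<sigma> <+> \<tau> | \<sigma> \<tau>. \<sigma> \<in> K \<and> \<tau> \<in> L}"

(* The alternating function with value \<eta> xs * \<eta>' ys on a list of vertices xs of K followed by
   vertices ys of L. The sign of the permutation that moves the vertices of K to the front,
   preserving the order within each factor, is given by its number of inversions. *)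
definition tensor ::
    "('a list \<Rightarrow> int) \<Rightarrow> ('b list \<Rightarrow> int) \<Rightarrow> ('a + 'b) list \<Rightarrow> int" where
  "tensor \<eta> \<eta>' zs =
     (-1) ^ card {(i, j). i < j \<and> j < length zs \<and> \<not> isl (zs ! i) \<and> isl (zs ! j)} *
     (\<eta> (map projl (filter isl zs)) * \<eta>' (map projr (filter (\<lambda>z. \<not> isl z) zs)))"

(* Extends a sequence by the convention that its term of index -1 is the empty cochain. *)
definition aug :: "(nat \<Rightarrow> 'a list \<Rightarrow> int) \<Rightarrow> int \<Rightarrow> 'a list \<Rightarrow> int" where
  "aug \<phi> i = (if i < 0 then empty_cochain else \<phi> (nat i))"

(* Component i of the j-th cochain, i = -1, ..., j; l = i div 2 means i = 2l or i = 2l + 1. *)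
definition join_component ::
    "nat \<Rightarrow> ('a \<Rightarrow> 'a) \<Rightarrow> ('b \<Rightarrow> 'b) \<Rightarrow> (nat \<Rightarrow> 'a list \<Rightarrow> int) \<Rightarrow> (nat \<Rightarrow> 'b list \<Rightarrow> int) \<Rightarrow>
     nat \<Rightarrow> int \<Rightarrow> ('a + 'b) list \<Rightarrow> int" where
  "join_component p t t' \<phi> \<phi>' j i =
     (let l = i div 2; \<psi> = aug \<phi>' (int j - i - 1) in
      if i = -1 then tensor empty_cochain (\<phi>' j)
      else if odd i then tensor (\<phi> (nat i)) (tpow t' (- (l + 1)) \<psi>)
      else if even j then tensor (\<phi> (nat i)) (tpow t' (- l) \<psi>)
      else \<Sum>q=0..p-2. tensor (smap p t (\<phi> (nat i)) - spart t q (\<phi> (nat i)))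
                              (tpow t' (- l + int q) \<psi>))"

definition join_resolution ::
    "nat \<Rightarrow> ('a \<Rightarrow> 'a) \<Rightarrow> ('b \<Rightarrow> 'b) \<Rightarrow> (nat \<Rightarrow> 'a list \<Rightarrow> int) \<Rightarrow> (nat \<Rightarrow> 'b list \<Rightarrow> int) \<Rightarrow>
     nat \<Rightarrow> ('a + 'b) list \<Rightarrow> int" where
  "join_resolution p t t' \<phi> \<phi>' j = (\<Sum>i = -1..int j. join_component p t t' \<phi> \<phi>' j i)"

lemma tensor_append:
  "tensor \<eta> \<eta>' (map Inl xs @ map Inr ys) = \<eta> xs * \<eta>' ys"
proof -
  have "{(i, j). i < j \<and> j < length (map Inl xs @ map Inr ys) \<and>
          \<not> isl ((map Inl xs @ map Inr ys) ! i) \<and> isl ((map Inl xs @ map Inr ys) ! j)} = {}"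
    by (auto simp: nth_append split: if_splits)
  then show ?thesis
    unfolding tensor_def by (simp only: card.empty power_0) (simp add: comp_def)
qed

lemma simplicial_complex_join:
  assumes "simplicial_complex K" "simplicial_complex L"
  shows "simplicial_complex (join K L)"
proof -
  have fin: "finite (join K L)"
  proof -
    have "join K L = (\<lambda>(\<sigma>, \<tau>). \<sigma> <+> \<tau>) ` (K \<times> L)"
      by (auto simp: join_def)
    then show ?thesis using assms by (simp add: simplicial_complex_def)
  qed
  have down: "\<rho> \<in> join K L" if "\<sigma> \<in> K" "\<tau> \<in> L" "\<rho> \<subseteq> \<sigma> <+> \<tau>" for \<rho> \<sigma> \<tau>
  proof -
    have "\<rho> = Inl -` \<rho> <+> Inr -` \<rho>"
      using that(3) by auto
    moreover have "Inl -` \<rho> \<in> K" "Inr -` \<rho> \<in> L"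
    proof -
      have "Inl -` \<rho> \<subseteq> \<sigma>" "Inr -` \<rho> \<subseteq> \<tau>" using that(3) by auto
      then show "Inl -` \<rho> \<in> K" "Inr -` \<rho> \<in> L"
        using that(1,2) assms unfolding simplicial_complex_def by blast+
    qed
    ultimately show ?thesis unfolding join_def by blast
  qed
  have e: "{} \<in> join K L"
    using assms unfolding join_def simplicial_complex_def
    by (intro CollectI exI[of _ "{}"]) auto
  have fin_el: "\<forall>\<rho>\<in>join K L. finite \<rho>"
    using assms by (auto simp: join_def simplicial_complex_def)
  have down': "\<forall>\<rho>\<in>join K L. \<forall>\<rho>'. \<rho>' \<subseteq> \<rho> \<longrightarrow> \<rho>' \<in> join K L"
  proof (intro ballI allI impI)
    fix \<rho> \<rho>' assume "\<rho> \<in> join K L" "\<rho>' \<subseteq> \<rho>"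
    moreover from this obtain \<sigma> \<tau> where "\<rho> = \<sigma> <+> \<tau>" "\<sigma> \<in> K" "\<tau> \<in> L"
      unfolding join_def by blast
    ultimately show "\<rho>' \<in> join K L" using down[of \<sigma> \<tau> \<rho>'] by simp
  qed
  show ?thesis
    unfolding simplicial_complex_def using fin fin_el e down' by (intro conjI)
qed

lemma map_sum_funpow:
  fixes f :: "'a \<Rightarrow> 'a" and g :: "'b \<Rightarrow> 'b"
  shows "map_sum f g ^^ k = map_sum (f ^^ k) (g ^^ k)"
proof
  fix z
  have "(map_sum f g ^^ k) (Inl x) = Inl ((f ^^ k) x)"
    for x by (induction k) auto
  moreover have "(map_sum f g ^^ k) (Inr y) = Inr ((g ^^ k) y)" for y
    by (induction k) auto
  ultimately show "(map_sum f g ^^ k) z = map_sum (f ^^ k) (g ^^ k) z"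
    by (cases z) auto
qed

lemma map_sum_image_Plus: "map_sum f g ` (A <+> B) = f ` A <+> g ` B"
  by (simp add: Plus_def image_Un image_image)

lemma Plus_eq_Plus_iff: "A <+> B = C <+> D \<longleftrightarrow> A = C \<and> B = D"
proof
  assume "A <+> B = C <+> D"
  then have "Inl -` (A <+> B) = Inl -` (C <+> D)" "Inr -` (A <+> B) = Inr -` (C <+> D)"
    by simp_all
  moreover have "Inl -` (A <+> B) = A" "Inr -` (A <+> B) = B"
    "Inl -` (C <+> D) = C" "Inr -` (C <+> D) = D" by auto
  ultimately show "A = C \<and> B = D" by simp
qed simp

lemma Zp_complex_join:
  assumes K: "Zp_complex p K t" and L: "Zp_complex p L t'"
  shows "Zp_complex p (join K L) (map_sum t t')"
proof -
  have sc: "simplicial_complex (join K L)"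
    using K L by (simp add: Zp_complex_def simplicial_complex_join)
  have e: "{} \<in> K" "{} \<in> L"
    using K L by (auto simp: Zp_complex_def simplicial_complex_def)
  have U: "\<Union>(join K L) = \<Union>K <+> \<Union>L"
  proof
    show "\<Union>(join K L) \<subseteq> \<Union>K <+> \<Union>L"
      unfolding join_def by fastforce
    have "\<sigma> <+> {} \<in> join K L" "{} <+> \<tau> \<in> join K L" if "\<sigma> \<in> K" "\<tau> \<in> L" for \<sigma> \<tau>
      using that e unfolding join_def by blast+
    then show "\<Union>K <+> \<Union>L \<subseteq> \<Union>(join K L)"
      using e by (blast intro: InlI InrI elim!: PlusE)
  qed
  have bt: "bij t" "bij t'"
    using K L by (auto simp: Zp_complex_def permutes_bij)
  have "bij (map_sum t t')"
  proof (rule o_bij)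
    show "map_sum (inv t) (inv t') \<circ> map_sum t t' = id"
      using bt by (simp only: map_sum.comp inv_o_cancel bij_is_inj sum.map_id0)
    show "map_sum t t' \<circ> map_sum (inv t) (inv t') = id"
      using bt by (simp only: map_sum.comp surj_iff[THEN iffD1] bij_is_surj sum.map_id0)
  qed
  moreover have "map_sum t t' z = z" if "z \<notin> \<Union>K <+> \<Union>L" for z
    using that K L by (cases z) (auto simp: Zp_complex_def permutes_def)
  ultimately have perm: "map_sum t t' permutes \<Union>(join K L)"
    unfolding U permutes_def by (simp add: bij_iff)
  have imK: "(\<lambda>\<sigma>. t ` \<sigma>) ` K = K" and imL: "(\<lambda>\<sigma>. t' ` \<sigma>) ` L = L"
    using K L by (auto simp: Zp_complex_def)
  have im: "(\<lambda>\<rho>. map_sum t t' ` \<rho>) ` join K L = join K L"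
  proof -
    have "(\<lambda>\<rho>. map_sum t t' ` \<rho>) ` join K L = join ((\<lambda>\<sigma>. t ` \<sigma>) ` K) ((\<lambda>\<sigma>. t' ` \<sigma>) ` L)"
    proof (intro set_eqI iffI)
      fix \<rho> assume "\<rho> \<in> (\<lambda>\<rho>. map_sum t t' ` \<rho>) ` join K L"
      then obtain \<sigma> \<tau> where "\<rho> = t ` \<sigma> <+> t' ` \<tau>" "\<sigma> \<in> K" "\<tau> \<in> L"
        unfolding join_def by (auto simp: map_sum_image_Plus)
      then show "\<rho> \<in> join ((\<lambda>\<sigma>. t ` \<sigma>) ` K) ((\<lambda>\<sigma>. t' ` \<sigma>) ` L)"
        unfolding join_def by blast
    next
      fix \<rho> assume "\<rho> \<in> join ((\<lambda>\<sigma>. t ` \<sigma>) ` K) ((\<lambda>\<sigma>. t' ` \<sigma>) ` L)"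
      then obtain \<sigma> \<tau> where "\<rho> = map_sum t t' ` (\<sigma> <+> \<tau>)" "\<sigma> \<in> K" "\<tau> \<in> L"
        unfolding join_def by (auto simp: map_sum_image_Plus)
      then show "\<rho> \<in> (\<lambda>\<rho>. map_sum t t' ` \<rho>) ` join K L"
        unfolding join_def by blast
    qed
    then show ?thesis by (simp add: imK imL)
  qed
  have pw: "map_sum t t' ^^ p = id"
    using K L by (simp add: map_sum_funpow Zp_complex_def sum.map_id0)
  have free: "(map_sum t t' ^^ k) ` \<rho> \<noteq> \<rho>"
    if "\<rho> \<in> join K L" "\<rho> \<noteq> {}" "\<not> p dvd k" for \<rho> k
  proof -
    obtain \<sigma> \<tau> where \<rho>: "\<rho> = \<sigma> <+> \<tau>" "\<sigma> \<in> K" "\<tau> \<in> L"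
      using \<open>\<rho> \<in> join K L\<close> unfolding join_def by blast
    with that(2) have "\<sigma> \<noteq> {} \<or> \<tau> \<noteq> {}" by auto
    then show ?thesis
      using \<rho> K L that(3)
      by (auto simp: map_sum_funpow map_sum_image_Plus Plus_eq_Plus_iff Zp_complex_def)
  qed
  show ?thesis
    unfolding Zp_complex_def using sc perm im pw free by blast
qed

end

theory Submission
  imports Defs
begin

text \<open>
  Apply the Leibniz rule to every component of \<open>\<Phi>\<^sub>j\<close> and collect, for each \<open>i\<close>, the terms with left factor
  built from \<open>\<phi>\<^sub>i\<close>: one comes from the coboundary of \<open>\<phi>\<^sub>i\<^sub>-\<^sub>1\<close>, the other from the coboundary of the factor
  in \<open>L\<close>. Their sum is \<open>d\<close> or \<open>s\<close> applied to component \<open>i\<close> of \<open>\<Phi>\<^sub>j\<^sub>+\<^sub>1\<close>. Besides the untwisted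
  identity for \<open>d\<close>, this needs three summations by parts over \<open>q\<close>, which rest on
  \<open>(s - s\<^sub>q) d = t\<^sup>q\<^sup>+\<^sup>1 - 1\<close> and \<open>t (s - s\<^sub>q) = s - s\<^sub>q\<^sub>+\<^sub>1 + 1\<close>.

  That the tensor product of alternating functions is alternating, and the Leibniz rule, are proved by
  induction on the list of vertices: passing a vertex of \<open>L\<close> in front twists the left factor by
  \<open>(-1)\<close> to its length.
\<close>

section \<open>Finite sums of functions\<close>

lemma sum_atMost_first: "(\<Sum>q=0..Suc n. f q) = f 0 + (\<Sum>q=0..n. f (Suc q))"
  for f :: "nat \<Rightarrow> 'x::comm_monoid_add"
  by (rule sum.atLeast0_atMost_Suc_shift[unfolded comp_def])

lemma sum_fun_eval: "(\<Sum>i\<in>A. f i) x = (\<Sum>i\<in>A. f i x)"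
  for f :: "'i \<Rightarrow> 'x \<Rightarrow> 'y::comm_monoid_add"
  by (induction A rule: infinite_finite_induct) auto

section \<open>Alternating functions of lists\<close>

text \<open>Adjacent swaps generate all permutations and, unlike permutations of indices, suit
  induction on the list: a common head is absorbed into \<open>us\<close>.\<close>

definition alternating :: "('a list \<Rightarrow> int) \<Rightarrow> bool" where
  "alternating c \<longleftrightarrow> (\<forall>us a b vs. c (us @ a # b # vs) = - c (us @ b # a # vs))"

lemma alternatingI: "(\<And>us a b vs. c (us @ a # b # vs) = - c (us @ b # a # vs)) \<Longrightarrow> alternating c"
  unfolding alternating_def by iprover

lemma alternatingD: "alternating c \<Longrightarrow> c (us @ a # b # vs) = - c (us @ b # a # vs)"
  unfolding alternating_def by iprover

lemma permute_list_transpose: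
  "permute_list (transpose (length us) (length us + Suc (length vs))) (us @ a # vs @ b # ws) =
   us @ b # vs @ a # ws"
proof (rule nth_equalityI)
  let ?i = "length us" and ?j = "length us + Suc (length vs)" and ?xs = "us @ a # vs @ b # ws"
  fix k assume "k < length (permute_list (transpose ?i ?j) ?xs)"
  then have k: "permute_list (transpose ?i ?j) ?xs ! k = ?xs ! transpose ?i ?j k"
    by (simp add: permute_list_def del: upt_Suc)
  have "k < ?i \<or> k = ?i \<or> (\<exists>m<length vs. k = ?i + Suc m) \<or> k = ?j \<or> (\<exists>m. k = ?j + Suc m)"
    by presburger
  then consider "k < ?i" | "k = ?i" | m where "m < length vs" "k = ?i + Suc m" | "k = ?j"
    | m where "k = ?j + Suc m" by blast
  then show "permute_list (transpose ?i ?j) ?xs ! k = (us @ b # vs @ a # ws) ! k"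
    unfolding k by cases (auto simp: transpose_def nth_append)
qed simp

lemma alternating_move:
  assumes "alternating c"
  shows "c (us @ a # vs @ ws) = (-1) ^ length vs * c (us @ vs @ a # ws)"
proof (induction vs arbitrary: us)
  case (Cons v vs)
  have "c (us @ a # (v # vs) @ ws) = - c ((us @ [v]) @ a # vs @ ws)"
    using alternatingD[OF assms, of us a v "vs @ ws"] by simp
  then show ?case by (simp only: Cons.IH) simp
qed simp

text \<open>Moving either entry across \<open>vs\<close> costs the same sign, so the two signs
  cancel and only one adjacent swap counts.\<close>

lemma alternating_swap:
  assumes "alternating c"
  shows "c (us @ b # vs @ a # ws) = - c (us @ a # vs @ b # ws)"
proof -
  have "c ((us @ vs) @ b # a # ws) = - c ((us @ vs) @ a # b # ws)"
    using assms by (rule alternatingD)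
  then show ?thesis
    using alternating_move[OF assms, of us b vs "a # ws"]
      alternating_move[OF assms, of us a vs "b # ws"] by simp
qed

text \<open>Every permutation of a finite set is a product of transpositions, and each contributes
  the sign computed in \<open>neg\<close>.\<close>

lemma alternating_permute:
  assumes alt: "alternating c" and "\<pi> permutes {..<length xs}"
  shows "c (permute_list \<pi> xs) = sign \<pi> * c xs"
proof -
  have neg: "c (permute_list (transpose i j) xs) = - c xs"
    if ij: "i < length xs" "j < length xs" "i \<noteq> j" for xs i j
  proof -
    have *: "c (permute_list (transpose i j) xs) = - c xs" if "i < j" "j < length xs" for i j
    proof -
      define us vs ws where "us = take i xs" and "vs = take (j - Suc i) (drop (Suc i) xs)"
        and "ws = drop (Suc j) xs"
      have "drop (Suc i) xs = vs @ drop (j - Suc i) (drop (Suc i) xs)"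
        unfolding vs_def by (simp only: append_take_drop_id)
      also have "drop (j - Suc i) (drop (Suc i) xs) = xs ! j # ws"
        using that by (simp add: ws_def Cons_nth_drop_Suc)
      finally have xs: "xs = us @ xs ! i # vs @ xs ! j # ws"
        using that id_take_nth_drop[of i xs] by (simp add: us_def)
      have "length us = i" "length us + Suc (length vs) = j"
        using that by (auto simp: us_def vs_def)
      then have "permute_list (transpose i j) xs = us @ xs ! j # vs @ xs ! i # ws"
        using permute_list_transpose[of us vs "xs ! i" "xs ! j" ws] xs by simp
      then show ?thesis
        using alternating_swap[OF alt, of us "xs ! j" vs "xs ! i" ws] xs by simp
    qed
    show ?thesis
      using ij *[of i j] *[of j i] by (cases "i < j") (auto simp: transpose_commute)
  qed
  \<comment> \<open>The quantifier over \<open>xs\<close> lets the induction hypothesis for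
    \<open>q\<close> be used on the list already permuted by \<open>transpose a b\<close>.\<close>
  have "\<forall>xs. length xs = n \<longrightarrow> c (permute_list \<pi> xs) = sign \<pi> * c xs"
    if "\<pi> permutes {..<n}" for n \<pi>
    using that finite_lessThan[of n]
  proof (induction rule: permutes_induct)
    case id
    then show ?case by simp
  next
    case (swap a b q)
    show ?case
    proof (intro allI impI)
      fix xs :: "'a list" assume n: "length xs = n"
      have "permutation q" using swap by (meson finite_lessThan permutation_permutes)
      then have "sign (transpose a b \<circ> q) = - sign q"
        using swap by (simp add: sign_compose permutation_swap_id sign_swap_id)
      moreover have "permute_list (transpose a b \<circ> q) xs
          = permute_list q (permute_list (transpose a b) xs)"
        using n swap by (simp add: permute_list_compose)
      ultimately show "c (permute_list (transpose a b \<circ> q) xs) = sign (transpose a b \<circ> q) * c xs"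
        using n swap neg[of a xs b] by simp
    qed
  qed
  with assms(2) show ?thesis by blast
qed

lemma permute_list_alternating:
  fixes c :: "'a list \<Rightarrow> int"
  assumes "\<And>xs \<pi>. \<pi> permutes {..<length xs} \<Longrightarrow> c (permute_list \<pi> xs) = sign \<pi> * c xs"
  shows "alternating c"
proof (rule alternatingI)
  fix us vs :: "'a list" and a b :: 'a
  let ?\<pi> = "transpose (length us) (Suc (length us))" and ?xs = "us @ b # a # vs"
  have "permute_list ?\<pi> ?xs = us @ a # b # vs"
    using permute_list_transpose[of us "[]" b a vs] by simp
  moreover have "?\<pi> permutes {..<length ?xs}" by (rule permutes_swap_id) auto
  ultimately show "c (us @ a # b # vs) = - c ?xs"
    using assms[of ?\<pi> ?xs] by (simp add: sign_swap_id)
qed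

section \<open>Membership in the cochain groups\<close>

lemma cochains_iff:
  "c \<in> cochains K n \<longleftrightarrow>
     (\<forall>xs. c xs \<noteq> 0 \<longrightarrow> distinct xs \<and> set xs \<in> K \<and> int (length xs) = n + 1) \<and> alternating c"
  (is "_ \<longleftrightarrow> ?S \<and> _")
proof -
  let ?P = "\<forall>xs \<pi>. \<pi> permutes {..<length xs} \<longrightarrow> c (permute_list \<pi> xs) = sign \<pi> * c xs"
  have "?P \<longleftrightarrow> alternating c"
  proof
    assume ?P
    then show "alternating c"
      by (intro permute_list_alternating) iprover
  qed (iprover intro: alternating_permute)
  moreover have "c \<in> cochains K n \<longleftrightarrow> ?S \<and> ?P"
    unfolding cochains_def by (rule mem_Collect_eq)
  ultimately show ?thesis by (simp only:)
qed

lemma cochains_support: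
  assumes "c \<in> cochains K n" "\<not> (distinct xs \<and> set xs \<in> K \<and> int (length xs) = n + 1)"
  shows "c xs = 0"
  using assms unfolding cochains_iff by metis

lemma cochains_zero: "0 \<in> cochains K n"
  by (simp add: cochains_def)

lemma cochains_add:
  assumes "a \<in> cochains K n" "b \<in> cochains K n"
  shows "a + b \<in> cochains K n"
proof -
  have "alternating (a + b)"
  proof (rule alternatingI)
    fix us x y vs
    show "(a + b) (us @ x # y # vs) = - (a + b) (us @ y # x # vs)"
      using assms alternatingD[of a us x y vs] alternatingD[of b us x y vs]
      by (simp add: cochains_iff)
  qed
  moreover have "a xs \<noteq> 0 \<or> b xs \<noteq> 0" if "(a + b) xs \<noteq> 0" for xs
    using that by auto
  ultimately show ?thesis
    using assms unfolding cochains_iff by metis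
qed

lemma cochains_diff:
  assumes "a \<in> cochains K n" "b \<in> cochains K n"
  shows "a - b \<in> cochains K n"
proof -
  have "alternating (a - b)"
  proof (rule alternatingI)
    fix us x y vs
    show "(a - b) (us @ x # y # vs) = - (a - b) (us @ y # x # vs)"
      using assms alternatingD[of a us x y vs] alternatingD[of b us x y vs]
      by (simp add: cochains_iff)
  qed
  moreover have "a xs \<noteq> 0 \<or> b xs \<noteq> 0" if "(a - b) xs \<noteq> 0" for xs
    using that by auto
  ultimately show ?thesis
    using assms unfolding cochains_iff by metis
qed

lemma cochains_sum: "(\<And>i. i \<in> I \<Longrightarrow> f i \<in> cochains K n) \<Longrightarrow> (\<Sum>i\<in>I. f i) \<in> cochains K n"
  by (induction I rule: infinite_finite_induct) (auto intro: cochains_zero cochains_add)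

lemma empty_cochain_cochains:
  assumes "{} \<in> K"
  shows "empty_cochain \<in> cochains K (-1)"
proof -
  have "alternating empty_cochain"
    by (rule alternatingI) (simp add: empty_cochain_def)
  then show ?thesis
    using assms by (simp add: cochains_iff empty_cochain_def)
qed

section \<open>Tensor products\<close>

text \<open>Pairs with first index \<open>0\<close> are counted by the filter on the tail; all
  others are pairs of the tail shifted by \<open>Suc\<close>. This makes the sign in
  \<open>tensor\<close> recursive.\<close>

lemma card_inversions_Cons:
  "card {(i, j). i < j \<and> j < length (z # zs) \<and> P ((z # zs) ! i) \<and> Q ((z # zs) ! j)} =
   (if P z then length (filter Q zs) else 0) +
   card {(i, j). i < j \<and> j < length zs \<and> P (zs ! i) \<and> Q (zs ! j)}"
proof -
  let ?A = "(\<lambda>j. (0::nat, Suc j)) ` {j. j < length zs \<and> P z \<and> Q (zs ! j)}"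
  let ?C = "{(i, j). i < j \<and> j < length zs \<and> P (zs ! i) \<and> Q (zs ! j)}"
  have "{(i, j). i < j \<and> j < length (z # zs) \<and> P ((z # zs) ! i) \<and> Q ((z # zs) ! j)} =
    ?A \<union> map_prod Suc Suc ` ?C"
  proof (intro set_eqI iffI)
    fix x assume "x \<in> {(i, j). i < j \<and> j < length (z # zs) \<and> P ((z # zs) ! i) \<and> Q ((z # zs) ! j)}"
    then obtain i j where x: "x = (i, j)" "i < j" "j < length (z # zs)"
      "P ((z # zs) ! i)" "Q ((z # zs) ! j)" by blast
    obtain j' where j: "j = Suc j'" using x(2) by (cases j) auto
    show "x \<in> ?A \<union> map_prod Suc Suc ` ?C"
    proof (cases i)
      case 0
      then show ?thesis using x j by auto
    next
      case (Suc i')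
      then have "x = map_prod Suc Suc (i', j')" "(i', j') \<in> ?C" using x j by auto
      then show ?thesis by blast
    qed
  qed auto
  moreover have "card (?A \<union> map_prod Suc Suc ` ?C) = card ?A + card (map_prod Suc Suc ` ?C)"
  proof (rule card_Un_disjoint)
    have "finite ?C"
      by (rule finite_subset[of _ "{..<length zs} \<times> {..<length zs}"]) auto
    then show "finite (map_prod Suc Suc ` ?C)" by blast
  qed auto
  moreover have "card ?A = (if P z then length (filter Q zs) else 0)"
    by (auto simp: card_image inj_on_def length_filter_conv_card)
  moreover have "card (map_prod Suc Suc ` ?C) = card ?C"
    by (rule card_image) (auto simp: inj_on_def)
  ultimately show ?thesis by simp
qed

text \<open>On a cochain of degree \<open>i\<close> this is the sign \<open>(-1)^(i+1)\<close> of
  the Leibniz rule. Written through the length, it makes sense for arbitrary functions, as induction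
  on lists requires.\<close>

definition twist :: "('a list \<Rightarrow> int) \<Rightarrow> 'a list \<Rightarrow> int" where
  "twist c xs = (-1) ^ length xs * c xs"

lemma twist_twist [simp]: "twist (twist c) = c"
  by (rule ext) (simp add: twist_def)

lemma tensor_Nil [simp]: "tensor \<eta> \<eta>' [] = \<eta> [] * \<eta>' []"
  using tensor_append[of \<eta> \<eta>' "[]" "[]"] by simp

lemma tensor_Inl: "tensor \<eta> \<eta>' (Inl x # zs) = tensor (\<lambda>xs. \<eta> (x # xs)) \<eta>' zs"
  unfolding tensor_def by (subst card_inversions_Cons) simp

text \<open>A vertex of \<open>L\<close> at the head forms an inversion with each vertex of
  \<open>K\<close> behind it; a vertex of \<open>K\<close> at the head forms none.\<close>

lemma tensor_Inr: "tensor \<eta> \<eta>' (Inr y # zs) = tensor (twist \<eta>) (\<lambda>ys. \<eta>' (y # ys)) zs"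
  unfolding tensor_def by (subst card_inversions_Cons) (simp add: power_add twist_def)

lemma twist_Cons: "twist (\<lambda>xs. c (x # xs)) = - (\<lambda>xs. twist c (x # xs))"
  by (rule ext) (simp add: twist_def)

lemma tensor_minus_left: "tensor (- a) b = - tensor a b"
  by (rule ext) (simp add: tensor_def)

lemma tensor_minus_right: "tensor a (- b) = - tensor a b"
  by (rule ext) (simp add: tensor_def)

lemma tensor_add_left: "tensor (a + a') b = tensor a b + tensor a' b"
  by (rule ext) (simp add: tensor_def algebra_simps)

lemma tensor_diff_left: "tensor (a - a') b = tensor a b - tensor a' b"
  by (rule ext) (simp add: tensor_def algebra_simps)

lemma tensor_diff_right: "tensor a (b - b') = tensor a b - tensor a b'"
  by (rule ext) (simp add: tensor_def algebra_simps)

lemma tensor_zero_left [simp]: "tensor 0 b = 0"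
  by (rule ext) (simp add: tensor_def)

lemma tensor_zero_right [simp]: "tensor a 0 = 0"
  by (rule ext) (simp add: tensor_def)

lemma tensor_sum_right: "tensor a (\<Sum>i\<in>I. f i) = (\<Sum>i\<in>I. tensor a (f i))"
  by (rule ext) (simp add: tensor_def sum_fun_eval sum_distrib_left)

lemma tensor_sum_left: "tensor (\<Sum>i\<in>I. f i) b = (\<Sum>i\<in>I. tensor (f i) b)"
  by (rule ext) (simp add: tensor_def sum_fun_eval sum_distrib_left sum_distrib_right)

lemma tensor_map:
  "tensor \<eta> \<eta>' (map (map_sum f g) zs) = tensor (\<eta> \<circ> map f) (\<eta>' \<circ> map g) zs"
proof (induction zs arbitrary: \<eta> \<eta>')
  case (Cons z zs)
  have "twist \<eta> \<circ> map f = twist (\<eta> \<circ> map f)" for \<eta>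
    by (simp add: twist_def fun_eq_iff)
  with Cons show ?case
    by (cases z) (simp_all add: tensor_Inl tensor_Inr comp_def)
qed simp

lemma alternating_Cons: "alternating c \<Longrightarrow> alternating (\<lambda>xs. c (x # xs))"
proof (rule alternatingI)
  fix us a b vs
  assume "alternating c"
  then show "c (x # us @ a # b # vs) = - c (x # us @ b # a # vs)"
    using alternatingD[of c "x # us" a b vs] by simp
qed

lemma alternating_twist: "alternating c \<Longrightarrow> alternating (twist c)"
proof (rule alternatingI)
  fix us a b vs
  assume "alternating c"
  then show "twist c (us @ a # b # vs) = - twist c (us @ b # a # vs)"
    using alternatingD[of c us a b vs] by (simp add: twist_def)
qed

lemma alternating_head: "alternating c \<Longrightarrow> (\<lambda>xs. c (a # b # xs)) = - (\<lambda>xs. c (b # a # xs))"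
  using alternatingD[of c "[]" a b] by (intro ext) simp

lemma alternating_tensor:
  assumes "alternating \<eta>" "alternating \<eta>'"
  shows "alternating (tensor \<eta> \<eta>')"
proof -
  have "tensor \<eta> \<eta>' (us @ a # b # vs) = - tensor \<eta> \<eta>' (us @ b # a # vs)" for us a b vs
    using assms
  proof (induction us arbitrary: \<eta> \<eta>')
    case Nil
    have head: "tensor (\<lambda>xs. \<eta> (x # y # xs)) \<eta>' zs = - tensor (\<lambda>xs. \<eta> (y # x # xs)) \<eta>' zs"
      for x y zs
      using alternating_head[OF Nil(1), of x y] by (simp add: tensor_minus_left)
    have head': "tensor \<eta> (\<lambda>ys. \<eta>' (x # y # ys)) zs = - tensor \<eta> (\<lambda>ys. \<eta>' (y # x # ys)) zs"
      for x y zs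
      using alternating_head[OF Nil(2), of x y] by (simp add: tensor_minus_right)
    \<comment> \<open>Heads from the same factor swap by \<open>head\<close> or
      \<open>head'\<close>; two vertices of \<open>L\<close> twist twice, which cancels. For mixed
      heads the sign comes from \<open>twist_Cons\<close>: the twist counts the vertex of
      \<open>K\<close> in one order but not in the other.\<close>
    show ?case
      by (cases a; cases b)
        (simp_all add: tensor_Inl tensor_Inr twist_Cons tensor_minus_left, (rule head head')+)
  next
    case (Cons u us)
    then show ?case
      by (cases u) (simp_all add: tensor_Inl tensor_Inr alternating_Cons alternating_twist)
  qed
  then show ?thesis by (rule alternatingI)
qed

section \<open>Splitting a list of vertices of the join into its two factors\<close>

abbreviation left_part :: "('a + 'b) list \<Rightarrow> 'a list" where
  "left_part zs \<equiv> map projl (filter isl zs)"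

abbreviation right_part :: "('a + 'b) list \<Rightarrow> 'b list" where
  "right_part zs \<equiv> map projr (filter (\<lambda>z. \<not> isl z) zs)"

lemma set_parts: "set zs = set (left_part zs) <+> set (right_part zs)"
proof (intro set_eqI)
  fix z
  show "z \<in> set zs \<longleftrightarrow> z \<in> set (left_part zs) <+> set (right_part zs)"
    by (cases z) (force simp: image_iff isl_def)+
qed

lemma distinct_parts: "distinct zs \<longleftrightarrow> distinct (left_part zs) \<and> distinct (right_part zs)"
proof (induction zs)
  case (Cons z zs)
  have "z \<in> set zs \<longleftrightarrow> z \<in> set (left_part zs) <+> set (right_part zs)"
    using set_parts[of zs] by blast
  with Cons show ?case by (cases z) auto
qed simp

lemma length_parts: "length zs = length (left_part zs) + length (right_part zs)"
  by (induction zs) auto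

lemma set_in_join_iff:
  "set zs \<in> join K L \<longleftrightarrow> set (left_part zs) \<in> K \<and> set (right_part zs) \<in> L"
  by (subst set_parts) (auto simp: join_def Plus_eq_Plus_iff simp del: set_map)

lemma tensor_cochains:
  assumes "\<eta> \<in> cochains K i" "\<eta>' \<in> cochains L j" "n = i + j + 1"
  shows "tensor \<eta> \<eta>' \<in> cochains (join K L) n"
proof -
  have "distinct zs \<and> set zs \<in> join K L \<and> int (length zs) = n + 1" if "tensor \<eta> \<eta>' zs \<noteq> 0" for zs
  proof -
    have "\<eta> (left_part zs) \<noteq> 0" "\<eta>' (right_part zs) \<noteq> 0"
      using that by (auto simp: tensor_def)
    then show ?thesis
      using assms cochains_support[of \<eta>] cochains_support[of \<eta>'] distinct_parts[of zs]
        set_in_join_iff[of zs] length_parts[of zs] by (smt (verit) of_nat_add)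
  qed
  then show ?thesis
    using assms alternating_tensor unfolding cochains_iff by blast
qed

section \<open>The Leibniz rule\<close>

text \<open>The coboundary without the restriction to simplices. Its Leibniz rule holds for all
  functions on lists, so the induction carries no simplex condition.\<close>

definition face_sum :: "('a list \<Rightarrow> int) \<Rightarrow> 'a list \<Rightarrow> int" where
  "face_sum c xs = (\<Sum>i<length xs. (-1) ^ i * c (take i xs @ drop (Suc i) xs))"

lemma coboundary_face_sum:
  "coboundary K c xs = (if distinct xs \<and> set xs \<in> K then face_sum c xs else 0)"
  by (simp add: coboundary_def face_sum_def)

lemma face_sum_Nil [simp]: "face_sum c [] = 0"
  by (simp add: face_sum_def)

lemma face_sum_Cons: "face_sum c (x # xs) = c xs - face_sum (\<lambda>ys. c (x # ys)) xs"
  unfolding face_sum_def length_Cons sum.lessThan_Suc_shift by (simp add: sum_negf)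

lemma face_sum_twist: "face_sum (twist c) = - twist (face_sum c)"
proof (rule ext)
  fix xs :: "'a list"
  have "(-1) ^ i * twist c (take i xs @ drop (Suc i) xs) =
      - ((-1) ^ length xs * ((-1) ^ i * c (take i xs @ drop (Suc i) xs)))" if "i < length xs" for i
    using that by (cases "length xs") (simp_all add: twist_def)
  then have "face_sum (twist c) xs =
      (\<Sum>i<length xs. - ((-1) ^ length xs * ((-1) ^ i * c (take i xs @ drop (Suc i) xs))))"
    unfolding face_sum_def by (intro sum.cong) auto
  then show "face_sum (twist c) xs = (- twist (face_sum c)) xs"
    by (simp add: face_sum_def twist_def sum_distrib_left sum_negf)
qed

text \<open>Deleting the head is one summand; the other faces recurse with the head absorbed into a
  factor, so the factors must be arbitrary. For a head in \<open>L\<close> the signs agree because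
  the twist anticommutes with \<open>face_sum\<close>.\<close>

lemma face_sum_tensor:
  "face_sum (tensor \<eta> \<eta>') zs =
     tensor (face_sum \<eta>) \<eta>' zs + tensor (twist \<eta>) (face_sum \<eta>') zs"
proof (induction zs arbitrary: \<eta> \<eta>')
  case (Cons z zs)
  show ?case
  proof (cases z)
    case (Inl x)
    have l: "(\<lambda>xs. face_sum \<eta> (x # xs)) = \<eta> - face_sum (\<lambda>xs. \<eta> (x # xs))"
      by (rule ext) (simp add: face_sum_Cons)
    have tw: "(\<lambda>xs. twist \<eta> (x # xs)) = - twist (\<lambda>xs. \<eta> (x # xs))"
      by (rule ext) (simp add: twist_def)
    show ?thesis
      unfolding Inl face_sum_Cons[of "tensor \<eta> \<eta>'"] by (simp add: tensor_Inl Cons.IH l tw tensor_diff_left tensor_minus_left)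
  next
    case (Inr y)
    have r: "(\<lambda>ys. face_sum \<eta>' (y # ys)) = \<eta>' - face_sum (\<lambda>ys. \<eta>' (y # ys))"
      by (rule ext) (simp add: face_sum_Cons)
    have tw: "tensor (face_sum (twist \<eta>)) b zs = - tensor (twist (face_sum \<eta>)) b zs" for b
      by (simp only: face_sum_twist tensor_minus_left uminus_apply)
    show ?thesis
      unfolding Inr face_sum_Cons[of "tensor \<eta> \<eta>'"] by (simp add: tensor_Inr Cons.IH r tw tensor_diff_right)
  qed
qed simp

lemma coboundary_tensor:
  assumes \<eta>: "\<eta> \<in> cochains K i" and \<eta>': "\<eta>' \<in> cochains L j" and "i \<ge> -1"
  shows "coboundary (join K L) (tensor \<eta> \<eta>') =
    tensor (coboundary K \<eta>) \<eta>' +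
    (if odd i then tensor \<eta> (coboundary L \<eta>') else - tensor \<eta> (coboundary L \<eta>'))"
proof (rule ext)
  fix zs :: "('a + 'b) list"
  let ?xs = "left_part zs" and ?ys = "right_part zs"
  have tw: "twist \<eta> = (if odd i then \<eta> else - \<eta>)"
  proof (rule ext)
    fix xs
    have "even (length xs) \<longleftrightarrow> odd i" if "\<eta> xs \<noteq> 0"
    proof -
      have "int (length xs) = i + 1" using that cochains_support[OF \<eta>, of xs] by blast
      then have "even (int (length xs)) \<longleftrightarrow> odd i" by simp
      then show ?thesis by simp
    qed
    then show "twist \<eta> xs = (if odd i then \<eta> else - \<eta>) xs"
      by (cases "\<eta> xs = 0") (auto simp: twist_def)
  qed
  \<comment> \<open>Off the simplices of the join the left side is \<open>0\<close> by definition.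
    On the right, a part that is not a simplex kills both its cochain and its coboundary, hence both
    terms.\<close>
  have zero: "\<eta> ?xs = 0" if "\<not> (distinct ?xs \<and> set ?xs \<in> K)"
    using that cochains_support[OF \<eta>, of ?xs] by blast
  have zero': "\<eta>' ?ys = 0" if "\<not> (distinct ?ys \<and> set ?ys \<in> L)"
    using that cochains_support[OF \<eta>', of ?ys] by blast
  have "coboundary (join K L) (tensor \<eta> \<eta>') zs =
      tensor (coboundary K \<eta>) \<eta>' zs + tensor (twist \<eta>) (coboundary L \<eta>') zs"
    unfolding coboundary_face_sum[of "join K L"] face_sum_tensor
    using zero zero' distinct_parts[of zs] set_in_join_iff[of zs K L]
    by (auto simp: tensor_def coboundary_face_sum twist_def simp del: set_map)
  then show "coboundary (join K L) (tensor \<eta> \<eta>') zs = (tensor (coboundary K \<eta>) \<eta>' +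
      (if odd i then tensor \<eta> (coboundary L \<eta>') else - tensor \<eta> (coboundary L \<eta>'))) zs"
    by (simp add: tw tensor_minus_left)
qed

lemma coboundary_sum: "coboundary K (\<Sum>i\<in>I. f i) = (\<Sum>i\<in>I. coboundary K (f i))"
  by (rule ext) (auto simp: coboundary_def sum_fun_eval sum_distrib_left intro: sum.swap)

section \<open>The group ring action\<close>

lemma funpow_cong_mod:
  assumes "t ^^ p = id" "m mod p = n mod p"
  shows "t ^^ m = t ^^ n"
proof -
  have "(t ^^ (k mod p)) x = (t ^^ k) x" for k x
    using assms(1) by (simp add: funpow_mod_eq)
  with assms(2) show ?thesis by (metis ext)
qed

text \<open>As \<open>t\<close> has finite order, its negative powers are natural powers too, and
  exponent laws become congruences mod \<open>p\<close>.\<close>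

lemma tpow_funpow:
  assumes t: "t ^^ p = id" and p: "p > 0"
  shows "tpow t k c = (\<lambda>xs. c (map (t ^^ nat (k mod int p)) xs))"
proof (cases "k \<ge> 0")
  case True
  then have "t ^^ nat k = t ^^ nat (k mod int p)"
    using p by (intro funpow_cong_mod[OF t]) (simp add: nat_mod_distrib)
  with True show ?thesis by (intro ext) (simp add: tpow_def)
next
  case False
  define m r where "m = nat (- k)" and "r = nat (k mod int p)"
  have "int (m + r) = k mod int p - k"
    using False p by (simp add: m_def r_def)
  then have "int (m + r) mod int p = 0"
    by (simp add: mod_diff_left_eq)
  then have "(m + r) mod p = 0" "(r + m) mod p = 0"
    by (simp_all only: flip: of_nat_mod) (simp_all add: add.commute)
  then have "t ^^ (m + r) = id" "t ^^ (r + m) = id"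
    using funpow_cong_mod[OF t, of _ 0] by auto
  then have "inv (t ^^ m) = t ^^ r"
    by (intro inv_unique_comp) (simp_all add: funpow_add)
  moreover have "bij t"
    using t p by (intro o_bij[of "t ^^ (p - 1)"]) (simp_all flip: funpow_Suc_right funpow.simps(2))
  ultimately have "inv t ^^ m = t ^^ r" by (simp add: inv_fn)
  with False show ?thesis by (intro ext) (simp add: tpow_def m_def r_def)
qed

lemma tpow_tpow:
  assumes t: "t ^^ p = id" and p: "p > 0"
  shows "tpow t j (tpow t k c) = tpow t (j + k) c"
proof -
  have "int ((nat (k mod int p) + nat (j mod int p)) mod p) = int (nat ((j + k) mod int p) mod p)"
    using p by (simp add: of_nat_mod mod_simps add.commute)
  then have "t ^^ (nat (k mod int p) + nat (j mod int p)) = t ^^ nat ((j + k) mod int p)"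
    by (intro funpow_cong_mod[OF t]) simp
  then show ?thesis
    by (simp add: tpow_funpow[OF t p] flip: funpow_add)
qed

lemma tpow_0 [simp]: "tpow t 0 c = c"
  by (rule ext) (simp add: tpow_def)

lemma tpow_period: "t ^^ p = id \<Longrightarrow> p > 0 \<Longrightarrow> tpow t (int p) c = c"
  by (rule ext) (simp add: tpow_def)

lemma tpow_add: "tpow t k (a + b) = tpow t k a + tpow t k b"
  by (rule ext) (simp add: tpow_def)

lemma tpow_diff: "tpow t k (a - b) = tpow t k a - tpow t k b"
  by (rule ext) (simp add: tpow_def)

lemma tpow_zero: "tpow t k 0 = 0"
  by (rule ext) (simp add: tpow_def)

lemma tpow_sum: "tpow t k (\<Sum>i\<in>I. f i) = (\<Sum>i\<in>I. tpow t k (f i))"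
  by (rule ext) (simp add: tpow_def sum_fun_eval)

lemma tpow_empty_cochain [simp]: "tpow t k empty_cochain = empty_cochain"
  by (rule ext) (simp add: tpow_def empty_cochain_def)

lemma dmap_empty_cochain [simp]: "dmap t empty_cochain = 0"
  by (simp add: dmap_def)

lemma spart_0 [simp]: "spart t 0 c = c"
  by (simp add: spart_def)

lemma spart_Suc: "spart t (Suc q) c = spart t q c + tpow t (int (Suc q)) c"
  by (simp add: spart_def)

lemma spart_sum: "spart t q (\<Sum>i\<in>I. f i) = (\<Sum>i\<in>I. spart t q (f i))"
  unfolding spart_def tpow_sum by (rule sum.swap)

lemma smap_sum: "smap p t (\<Sum>i\<in>I. f i) = (\<Sum>i\<in>I. smap p t (f i))"
  unfolding smap_def by (rule spart_sum)

lemma smap_add: "smap p t (a + b) = smap p t a + smap p t b"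
  by (simp add: smap_def spart_def tpow_add sum.distrib)

lemma dmap_sum: "dmap t (\<Sum>i\<in>I. f i) = (\<Sum>i\<in>I. dmap t (f i))"
  by (simp add: dmap_def tpow_sum sum_subtractf)

section \<open>Relations between \<open>s_q\<close>, \<open>s\<close> and \<open>d\<close>\<close>

context
  fixes t :: "'a \<Rightarrow> 'a" and p :: nat
  assumes t: "t ^^ p = id" and p: "p > 0"
begin

lemma tpow_spart: "tpow t k (spart t q c) = spart t q (tpow t k c)"
  by (simp add: spart_def tpow_sum tpow_tpow[OF t p] add.commute)

lemma tpow_dmap: "tpow t k (dmap t c) = tpow t k c - tpow t (k + 1) c"
  by (simp add: dmap_def tpow_diff tpow_tpow[OF t p])

text \<open>The geometric sum telescopes against \<open>1 - t\<close>; for \<open>q = p - 1\<close>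
  the period makes the result vanish.\<close>

lemma spart_dmap: "spart t q (dmap t c) = c - tpow t (int (Suc q)) c"
proof (induction q)
  case 0
  then show ?case by (simp add: dmap_def)
next
  case (Suc q)
  then show ?case by (simp add: spart_Suc tpow_dmap add.commute)
qed

lemma smap_dmap [simp]: "smap p t (dmap t c) = 0"
  using p spart_dmap[of "p - 1" c] by (simp add: smap_def tpow_period[OF t p])

text \<open>By \<open>s d = 0\<close>, one step of \<open>t\<close> does not change the value of
  \<open>s\<close>; induction in both directions covers negative exponents.\<close>

lemma smap_tpow [simp]: "smap p t (tpow t k c) = smap p t c"
proof (induction k rule: int_induct[where k = 0])
  case base
  then show ?case by simp
next
  have eq: "smap p t (tpow t k c) = smap p t (tpow t (k + 1) c)" for k
  proof -
    have "smap p t (dmap t (tpow t k c)) = 0" by simp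
    then have "smap p t (tpow t k c) - smap p t (tpow t (k + 1) c) = 0"
      by (simp add: dmap_def tpow_tpow[OF t p] smap_def spart_def tpow_diff sum_subtractf add.commute)
    then show ?thesis by simp
  qed
  {
    case (step1 i)
    then show ?case using eq[of i] by simp
  next
    case (step2 i)
    then show ?case using eq[of "i - 1"] by simp
  }
qed

lemma tpow_smap [simp]: "tpow t k (smap p t c) = smap p t c"
  using tpow_spart smap_tpow by (simp add: smap_def)

end

text \<open>\<open>stail p t q = s - s_q\<close> in the notation of the informal statement.\<close>

definition stail :: "nat \<Rightarrow> ('a \<Rightarrow> 'a) \<Rightarrow> nat \<Rightarrow> ('a list \<Rightarrow> int) \<Rightarrow> 'a list \<Rightarrow> int" where
  "stail p t q c = smap p t c - spart t q c"

lemma stail_0: "stail p t 0 c = smap p t c - c"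
  by (simp add: stail_def)

lemma stail_last: "stail p t (p - 1) c = 0"
  by (simp add: stail_def smap_def)

lemma stail_step: "stail p t q c = stail p t (Suc q) c + tpow t (int (Suc q)) c"
  by (simp add: stail_def spart_Suc)

lemma stail_dmap:
  assumes "t ^^ p = id" "p > 0"
  shows "stail p t q (dmap t c) = tpow t (int (Suc q)) c - c"
  using assms by (simp add: stail_def spart_dmap[OF assms])

text \<open>Multiplication by \<open>t\<close> fixes \<open>s\<close>, while in \<open>s_q\<close>
  it drops the term \<open>1\<close> and adds \<open>t^(q+1)\<close>; the dropped term is the extra
  \<open>c\<close>.\<close>

lemma tpow_stail:
  assumes t: "t ^^ p = id" and p: "p > 0"
  shows "tpow t 1 (stail p t q c) = stail p t (Suc q) c + c"
proof -
  have "tpow t 1 (spart t q c) = spart t q c - spart t q (dmap t c)"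
    by (simp only: tpow_spart[OF t p] dmap_def) (simp add: spart_def tpow_diff sum_subtractf)
  also have "\<dots> = spart t (Suc q) c - c"
    by (simp add: spart_dmap[OF t p] spart_Suc)
  finally show ?thesis
    by (simp add: stail_def tpow_diff t p)
qed

section \<open>Action of \<open>d\<close> and \<open>s\<close> on twisted tensor products: summation
  by parts\<close>

context
  fixes t :: "'a \<Rightarrow> 'a" and t' :: "'b \<Rightarrow> 'b" and p :: nat
  assumes t: "t ^^ p = id" and t': "t' ^^ p = id" and p: "p \<ge> 2"
begin

private lemma p0: "p > 0"
  using p by simp

lemma tpow_tensor:
  "tpow (map_sum t t') k (tensor a b) = tensor (tpow t k a) (tpow t' k b)"
proof -
  have "map_sum t t' ^^ p = id"
    using t t' by (simp add: map_sum_funpow sum.map_id0)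
  then show ?thesis
    by (intro ext) (simp add: tpow_funpow[OF t p0] tpow_funpow[OF t' p0] tpow_funpow[OF _ p0]
        map_sum_funpow tensor_map comp_def)
qed

text \<open>Add and subtract \<open>tensor a (tpow t' (- l) b)\<close>; the diagonal action takes
  the exponent \<open>- (l + 1)\<close> to \<open>- l\<close>.\<close>

lemma dmap_tensor:
  "dmap (map_sum t t') (tensor a (tpow t' (- (l + 1)) b)) =
   tensor (dmap t a) (tpow t' (- l) b) + tensor a (tpow t' (- (l + 1)) (dmap t' b))"
  by (simp add: dmap_def tpow_tensor tensor_diff_left tensor_diff_right tpow_diff
      tpow_tpow[OF t' p0])

lemma dmap_tensor_stail:
  "dmap (map_sum t t') (\<Sum>q=0..p-2. tensor (stail p t q a) (tpow t' (- l + int q) b)) =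
   tensor (smap p t a) (tpow t' (- l) b) - tensor a (smap p t' b)"
proof -
  obtain n where n: "p = Suc (Suc n)" using p by (metis Suc_le_D numeral_2_eq_2 Suc_le_mono)
  then have n2: "p - 2 = n" by simp
  define \<beta> where "\<beta> q = tpow t' (- l + int q) b" for q
  define F where "F q = tensor (stail p t q a) (\<beta> q)" for q
  have "tpow t' 1 (\<beta> q) = \<beta> (Suc q)" for q
    by (simp add: \<beta>_def tpow_tpow[OF t' p0] algebra_simps)
  \<comment> \<open>The diagonal action turns \<open>s - s_q\<close> into
    \<open>s - s_(q+1) + 1\<close> and \<open>\<beta> q\<close> into \<open>\<beta> (Suc q)\<close>,
    so the sum telescopes up to the terms from the extra \<open>1\<close>.\<close>
  then have "dmap (map_sum t t') (F q) = F q - F (Suc q) - tensor a (\<beta> (Suc q))" for q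
    by (simp add: F_def dmap_def tpow_tensor tpow_stail[OF t p0] tensor_add_left)
  then have "dmap (map_sum t t') (\<Sum>q=0..n. F q) =
      (\<Sum>q=0..n. F q - F (Suc q)) - (\<Sum>q=0..n. tensor a (\<beta> (Suc q)))"
    by (simp add: dmap_sum sum_subtractf)
  also have "(\<Sum>q=0..n. F q - F (Suc q)) = F 0 - F (Suc n)"
    by (simp add: atLeast0AtMost sum_telescope)
  \<comment> \<open>Here \<open>Suc n = p - 1\<close>, and \<open>s - s_(p-1) = 0\<close>.\<close>
  also have "F (Suc n) = 0"
    using stail_last[of p t a] by (simp add: F_def n)
  \<comment> \<open>The left factor of \<open>F 0\<close> is \<open>s a - a\<close>; its second part
    supplies the missing summand \<open>q = 0\<close>, completing the sum to all \<open>p\<close>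
    powers of \<open>t'\<close>.\<close>
  also have "F 0 - 0 - (\<Sum>q=0..n. tensor a (\<beta> (Suc q))) =
      tensor (smap p t a) (\<beta> 0) - (\<Sum>q=0..Suc n. tensor a (\<beta> q))"
    unfolding sum_atMost_first by (simp add: F_def stail_0 tensor_diff_left)
  also have "(\<Sum>q=0..Suc n. tensor a (\<beta> q)) = tensor a (smap p t' (\<beta> 0))"
    by (simp add: smap_def spart_def n \<beta>_def tpow_tpow[OF t' p0] tensor_sum_right add.commute
        del: sum.cl_ivl_Suc)
  finally show ?thesis
    by (simp only: F_def \<beta>_def n2 of_nat_0 add_0_right smap_tpow[OF t' p0])
qed

text \<open>Abel summation: \<open>d\<close> on the right factor is a difference in
  \<open>q\<close>. Shifted to the left factor it turns \<open>s - s_q\<close> into its decrement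
  \<open>t^(q+1)\<close>, which rebuilds the diagonal \<open>s\<close> term by term.\<close>

lemma smap_tensor:
  "smap p (map_sum t t') (tensor a (tpow t' (- l) b)) =
   tensor (smap p t a) (tpow t' (- l) b) -
   (\<Sum>q=0..p-2. tensor (stail p t q a) (tpow t' (- l + int q) (dmap t' b)))"
proof -
  obtain n where n: "p = Suc (Suc n)" using p by (metis Suc_le_D numeral_2_eq_2 Suc_le_mono)
  then have n2: "p - 2 = n" by simp
  define \<beta> where "\<beta> q = tpow t' (- l + int q) b" for q
  define F where "F q = tensor (stail p t q a) (\<beta> q)" for q
  have "tpow t' (- l + int q) (dmap t' b) = \<beta> q - \<beta> (Suc q)" for q
    by (simp add: \<beta>_def tpow_dmap[OF t' p0] algebra_simps)
  then have "tensor (stail p t q a) (tpow t' (- l + int q) (dmap t' b)) =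
      F q - F (Suc q) - tensor (tpow t (int (Suc q)) a) (\<beta> (Suc q))" for q
    using stail_step[of p t q a] by (simp add: F_def tensor_diff_right tensor_add_left)
  then have "(\<Sum>q=0..n. tensor (stail p t q a) (tpow t' (- l + int q) (dmap t' b))) =
      (\<Sum>q=0..n. F q - F (Suc q)) - (\<Sum>q=0..n. tensor (tpow t (int (Suc q)) a) (\<beta> (Suc q)))"
    by (simp add: sum_subtractf)
  also have "(\<Sum>q=0..n. F q - F (Suc q)) = F 0 - F (Suc n)"
    by (simp add: atLeast0AtMost sum_telescope)
  also have "F (Suc n) = 0"
    using stail_last[of p t a] by (simp add: F_def n)
  also have "F 0 - 0 - (\<Sum>q=0..n. tensor (tpow t (int (Suc q)) a) (\<beta> (Suc q))) =
      tensor (smap p t a) (\<beta> 0) - (\<Sum>q=0..Suc n. tensor (tpow t (int q) a) (\<beta> q))"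
    unfolding sum_atMost_first by (simp add: F_def stail_0 tensor_diff_left)
  also have "(\<Sum>q=0..Suc n. tensor (tpow t (int q) a) (\<beta> q)) =
      smap p (map_sum t t') (tensor a (\<beta> 0))"
    by (simp add: smap_def spart_def n \<beta>_def tpow_tensor tpow_tpow[OF t' p0] add.commute
        del: sum.cl_ivl_Suc)
  finally show ?thesis
    by (simp only: \<beta>_def n2 of_nat_0 add_0_right diff_diff_eq2 add_diff_cancel_left')
qed

text \<open>Now \<open>d\<close> sits on the left factor, where
  \<open>(s - s_q) d = t^(q+1) - 1\<close> splits the sum. The part from \<open>- 1\<close> cancels
  all but the last summand of \<open>tensor a (smap p t' b)\<close>.\<close>

lemma smap_tensor':
  "smap p (map_sum t t') (tensor a (tpow t' (- (l + 1)) b)) =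
   (\<Sum>q=0..p-2. tensor (stail p t q (dmap t a)) (tpow t' (- l + int q) b)) + tensor a (smap p t' b)"
proof -
  obtain n where n: "p = Suc (Suc n)" using p by (metis Suc_le_D numeral_2_eq_2 Suc_le_mono)
  define \<beta> where "\<beta> q = tpow t' (- l + int q) b" for q
  \<comment> \<open>By \<open>- l + (p - 1) = - (l + 1) + p\<close>, the uncancelled summand
    \<open>q = p - 1\<close> is the term \<open>k = 0\<close> of the diagonal
    \<open>s\<close>.\<close>
  have "\<beta> (Suc n) = tpow t' (- (l + 1)) (tpow t' (int p) b)"
    by (simp add: \<beta>_def n tpow_tpow[OF t' p0] algebra_simps)
  then have last: "\<beta> (Suc n) = tpow t' (- (l + 1)) b"
    by (simp only: tpow_period[OF t' p0])
  have "(\<Sum>q=0..n. tensor (stail p t q (dmap t a)) (\<beta> q)) =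
      (\<Sum>q=0..n. tensor (tpow t (int (Suc q)) a) (\<beta> q)) - (\<Sum>q=0..n. tensor a (\<beta> q))"
    by (simp add: stail_dmap[OF t p0] tensor_diff_left sum_subtractf)
  moreover have "tensor a (smap p t' b) = (\<Sum>q=0..Suc n. tensor a (\<beta> q))"
  proof -
    have "tensor a (smap p t' (tpow t' (- l) b)) = (\<Sum>q=0..Suc n. tensor a (\<beta> q))"
      by (simp add: smap_def spart_def n \<beta>_def tpow_tpow[OF t' p0] tensor_sum_right add.commute
          del: sum.cl_ivl_Suc)
    then show ?thesis by (simp only: smap_tpow[OF t' p0])
  qed
  moreover have "smap p (map_sum t t') (tensor a (tpow t' (- (l + 1)) b)) =
      tensor a (\<beta> (Suc n)) + (\<Sum>q=0..n. tensor (tpow t (int (Suc q)) a) (\<beta> q))"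
  proof -
    have "tpow t' (int (Suc q)) (tpow t' (- (l + 1)) b) = \<beta> q" for q
      by (simp add: \<beta>_def tpow_tpow[OF t' p0] algebra_simps)
    then show ?thesis
      by (simp add: smap_def spart_def n tpow_tensor last sum_atMost_first del: sum.cl_ivl_Suc of_nat_Suc)
  qed
  ultimately show ?thesis
    by (simp add: n \<beta>_def)
qed

end

section \<open>The resolution of the join\<close>

text \<open>A face is the empty list only for a single vertex. This makes
  \<open>s \<phi>_0 = 1\<close> the coboundary relation at the odd index \<open>-1\<close>.\<close>

lemma coboundary_empty_cochain: "coboundary K empty_cochain = one_cochain K"
proof (rule ext)
  fix xs :: "'a list"
  consider "xs = []" | v where "xs = [v]" | "length xs \<ge> 2"
    by (cases xs rule: remdups_adj.cases) auto
  then show "coboundary K empty_cochain xs = one_cochain K xs"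
  proof cases
    case 3
    then have "xs \<noteq> [v]" for v by auto
    moreover from 3 have "empty_cochain (take i xs @ drop (Suc i) xs) = 0" for i
      by (auto simp: empty_cochain_def)
    ultimately show ?thesis
      by (simp add: coboundary_def one_cochain_def)
  qed (auto simp: coboundary_def one_cochain_def empty_cochain_def)
qed

section \<open>The action on simplices, cochain groups and coboundaries\<close>

lemma funpow_image_in_iff:
  assumes "inj t" "(\<lambda>\<sigma>. t ` \<sigma>) ` K = K"
  shows "(t ^^ n) ` \<sigma> \<in> K \<longleftrightarrow> \<sigma> \<in> K"
proof (induction n)
  case (Suc n)
  have "t ` \<tau> \<in> K \<longleftrightarrow> \<tau> \<in> K" for \<tau>
  proof
    assume "t ` \<tau> \<in> K"
    then obtain \<rho> where "\<rho> \<in> K" "t ` \<tau> = t ` \<rho>" using assms(2) by blast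
    then show "\<tau> \<in> K" using assms(1) by (simp add: inj_image_eq_iff)
  next
    assume "\<tau> \<in> K"
    then show "t ` \<tau> \<in> K" using assms(2) by blast
  qed
  from this[of "(t ^^ n) ` \<sigma>"] Suc show ?case by (simp add: image_comp)
qed simp

text \<open>Presents every integer power of the action as relabelling along an injective map that
  preserves and reflects simplices, so negative exponents need no separate treatment.\<close>

lemma Zp_complex_tpow:
  assumes K: "Zp_complex p K t" and p: "p > 0"
  obtains f where "inj f" "\<And>\<sigma>. f ` \<sigma> \<in> K \<longleftrightarrow> \<sigma> \<in> K" "\<And>c. tpow t k c = (\<lambda>xs. c (map f xs))"
proof
  have t: "t ^^ p = id" "inj t" "(\<lambda>\<sigma>. t ` \<sigma>) ` K = K"
    using K by (auto simp: Zp_complex_def permutes_inj)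
  let ?f = "t ^^ nat (k mod int p)"
  show "inj ?f" by (rule inj_fn[OF t(2)])
  show "?f ` \<sigma> \<in> K \<longleftrightarrow> \<sigma> \<in> K" for \<sigma>
    by (rule funpow_image_in_iff[OF t(2,3)])
  show "tpow t k c = (\<lambda>xs. c (map ?f xs))" for c
    by (rule tpow_funpow[OF t(1) p])
qed

lemma coboundary_tpow:
  assumes "Zp_complex p K t" "p > 0"
  shows "coboundary K (tpow t k c) = tpow t k (coboundary K c)"
proof -
  obtain f where f: "inj f" "\<And>\<sigma>. f ` \<sigma> \<in> K \<longleftrightarrow> \<sigma> \<in> K" "\<And>c. tpow t k c = (\<lambda>xs. c (map f xs))"
    using Zp_complex_tpow[OF assms, of k] by metis
  have "distinct (map f xs) = distinct xs" for xs
    using inj_on_subset[OF f(1)] by (simp add: distinct_map)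
  then show ?thesis
    by (intro ext) (simp add: f coboundary_def take_map drop_map)
qed

lemma tpow_cochains:
  assumes "Zp_complex p K t" "p > 0" and c: "c \<in> cochains K n"
  shows "tpow t k c \<in> cochains K n"
proof -
  obtain f where f: "inj f" "\<And>\<sigma>. f ` \<sigma> \<in> K \<longleftrightarrow> \<sigma> \<in> K" "\<And>c. tpow t k c = (\<lambda>xs. c (map f xs))"
    using Zp_complex_tpow[OF assms(1,2), of k] by metis
  have "distinct (map f xs) = distinct xs" for xs
    using inj_on_subset[OF f(1)] by (simp add: distinct_map)
  moreover have "alternating (tpow t k c)"
  proof (rule alternatingI)
    fix us a b vs
    show "tpow t k c (us @ a # b # vs) = - tpow t k c (us @ b # a # vs)"
      using c alternatingD[of c "map f us" "f a" "f b" "map f vs"] by (simp add: cochains_iff f)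
  qed
  moreover have "distinct (map f xs) \<and> set (map f xs) \<in> K \<and> int (length (map f xs)) = n + 1"
    if "tpow t k c xs \<noteq> 0" for xs
    using that cochains_support[OF c, of "map f xs"] unfolding f by blast
  ultimately show ?thesis
    unfolding cochains_iff by (simp add: f(2))
qed

lemma spart_cochains:
  assumes "Zp_complex p K t" "p > 0" "c \<in> cochains K n"
  shows "spart t q c \<in> cochains K n"
  unfolding spart_def by (intro cochains_sum tpow_cochains[OF assms])

lemma stail_cochains:
  assumes "Zp_complex p K t" "p > 0" "c \<in> cochains K n"
  shows "stail p t q c \<in> cochains K n"
  unfolding stail_def smap_def by (intro cochains_diff spart_cochains[OF assms])

lemma coboundary_diff: "coboundary K (a - b) = coboundary K a - coboundary K b"
  by (rule ext) (simp add: coboundary_def sum_subtractf right_diff_distrib)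

lemma coboundary_stail:
  assumes "Zp_complex p K t" "p > 0"
  shows "coboundary K (stail p t q c) = stail p t q (coboundary K c)"
  by (simp add: stail_def smap_def spart_def coboundary_diff coboundary_sum coboundary_tpow[OF assms])

section \<open>Resolutions and components extended to the index -1\<close>

lemma aug_cochains:
  assumes "Zp_complex p K t" "resolution_of_one p K t \<phi>" "i \<ge> -1"
  shows "aug \<phi> i \<in> cochains K i"
proof (cases "i = -1")
  case True
  have "{} \<in> K" using assms(1) by (simp add: Zp_complex_def simplicial_complex_def)
  with True show ?thesis by (simp add: aug_def empty_cochain_cochains)
next
  case False
  then have "\<phi> (nat i) \<in> cochains K (int (nat i))"
    using assms(2) by (simp only: resolution_of_one_def)
  with False assms(3) show ?thesis by (simp add: aug_def)
qed

lemma coboundary_aug: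
  assumes "resolution_of_one p K t \<phi>" "i \<ge> -1"
  shows "coboundary K (aug \<phi> i) =
    (if odd i then smap p t (aug \<phi> (i + 1)) else dmap t (aug \<phi> (i + 1)))"
proof (cases "i = -1")
  case True
  with assms(1) show ?thesis
    by (simp add: aug_def coboundary_empty_cochain resolution_of_one_def)
next
  case False
  with assms(2) obtain n where n: "i = int n" using nonneg_int_cases[of i] by force
  have "nat (int n + 1) = n + 1" by simp
  with assms(1) show ?thesis
    by (simp add: aug_def n resolution_of_one_def)
qed

text \<open>Component \<open>-1\<close> joins the odd case: \<open>-1 div 2 = -1\<close> makes the
  exponent of \<open>t'\<close> zero, and \<open>j - (-1) - 1 = j\<close>.\<close>

lemma join_component_aug:
  assumes "i \<ge> -1"
  shows "join_component p t t' \<phi> \<phi>' j i =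
    (if odd i then tensor (aug \<phi> i) (tpow t' (- (i div 2 + 1)) (aug \<phi>' (int j - i - 1)))
     else if even j then tensor (aug \<phi> i) (tpow t' (- (i div 2)) (aug \<phi>' (int j - i - 1)))
     else \<Sum>q=0..p-2. tensor (stail p t q (aug \<phi> i))
            (tpow t' (- (i div 2) + int q) (aug \<phi>' (int j - i - 1))))"
proof (cases "i = -1")
  case False
  then have "aug \<phi> i = \<phi> (nat i)" using assms by (simp add: aug_def)
  with False show ?thesis by (simp add: join_component_def Let_def stail_def)
qed (simp add: join_component_def aug_def)

text \<open>Both ranges extend to \<open>-1..j+1\<close> at the cost of one vanishing term each;
  this aligns the coboundary terms that share a left factor.\<close>

lemma sum_shift_diagonal:
  fixes U V :: "int \<Rightarrow> 'x::comm_monoid_add"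
  assumes "U (-1) = 0" "V (int j + 1) = 0"
  shows "(\<Sum>i=-1..int j. U (i + 1) + V i) = (\<Sum>i=-1..int j + 1. U i + V i)"
proof -
  have "(\<Sum>i=-1..int j. U (i + 1)) = (\<Sum>i=0..int j + 1. U i)"
    by (rule sum.reindex_bij_witness[of _ "\<lambda>i. i - 1" "\<lambda>i. i + 1"]) auto
  moreover have "(\<Sum>i=-1..int j + 1. U i) = U (-1) + (\<Sum>i=0..int j + 1. U i)"
  proof -
    have "{-1..int j + 1} = insert (-1) {0..int j + 1}" by auto
    then show ?thesis by simp
  qed
  moreover have "(\<Sum>i=-1..int j + 1. V i) = V (int j + 1) + (\<Sum>i=-1..int j. V i)"
  proof -
    have "{-1..int j + 1} = insert (int j + 1) {-1..int j}" by auto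
    then show ?thesis by simp
  qed
  ultimately show ?thesis
    using assms by (simp add: sum.distrib)
qed

lemma join_component_cochains:
  assumes K: "Zp_complex p K t" and L: "Zp_complex p L t'" and p: "p > 0"
    and \<phi>: "resolution_of_one p K t \<phi>" and \<phi>': "resolution_of_one p L t' \<phi>'"
    and i: "-1 \<le> i" "i \<le> int j"
  shows "join_component p t t' \<phi> \<phi>' j i \<in> cochains (join K L) (int j)"
proof -
  have A: "aug \<phi> i \<in> cochains K i" "stail p t q (aug \<phi> i) \<in> cochains K i" for q
    using aug_cochains[OF K \<phi> i(1)] stail_cochains[OF K p] by auto
  have B: "tpow t' k (aug \<phi>' (int j - i - 1)) \<in> cochains L (int j - i - 1)" for k
    using i by (intro tpow_cochains[OF L p] aug_cochains[OF L \<phi>']) simp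
  have "int j = i + (int j - i - 1) + 1" by simp
  note mem = tensor_cochains[OF A(1) B this] tensor_cochains[OF A(2) B this]
  show ?thesis
    unfolding join_component_aug[OF i(1)] by (simp add: mem cochains_sum)
qed

text \<open>
  The coboundary of component \<open>i\<close> is \<open>U (i + 1) + V i\<close>, where \<open>U\<close> collects the terms with the coboundary on
  the left factor. Starting at the index \<open>-1\<close>, with \<open>\<phi>\<^sub>-\<^sub>1 = \<emptyset>\<close> and \<open>d\<emptyset> = 0\<close>, makes the boundary
  terms \<open>U (-1)\<close> and \<open>V (j + 1)\<close> vanish, so that every component of the target has the same form.
\<close>

lemma coboundary_join_resolution:
  assumes K: "Zp_complex p K t" and L: "Zp_complex p L t'" and p: "p \<ge> 2"
    and \<phi>: "resolution_of_one p K t \<phi>" and \<phi>': "resolution_of_one p L t' \<phi>'"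
  shows "coboundary (join K L) (join_resolution p t t' \<phi> \<phi>' j) =
    (if even j then dmap (map_sum t t') (join_resolution p t t' \<phi> \<phi>' (j + 1))
     else smap p (map_sum t t') (join_resolution p t t' \<phi> \<phi>' (j + 1)))"
proof -
  have p0: "p > 0" using p by simp
  have t: "t ^^ p = id" "t' ^^ p = id" using K L by (simp_all add: Zp_complex_def)
  let ?A = "aug \<phi>" and ?B = "aug \<phi>'" and ?C = "join_component p t t' \<phi> \<phi>'" and ?T = "map_sum t t'"
  define U where "U i =
    (if even i then tensor (smap p t (?A i)) (tpow t' (- (i div 2)) (?B (int j - i)))
     else if even j then tensor (dmap t (?A i)) (tpow t' (- (i div 2)) (?B (int j - i)))
     else \<Sum>q=0..p-2. tensor (stail p t q (dmap t (?A i))) (tpow t' (- (i div 2) + int q) (?B (int j - i))))" for i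
  \<comment> \<open>The sign is that of the Leibniz rule in degree \<open>i\<close>, and the parity
    of \<open>j - i - 1\<close> decides between \<open>d\<close> and \<open>s\<close>. Where
    \<open>s\<close> appears it has absorbed the power of \<open>t'\<close>.\<close>
  define V where "V i =
    (if even j then
       if odd i then tensor (?A i) (tpow t' (- (i div 2 + 1)) (dmap t' (?B (int j - i))))
       else - tensor (?A i) (smap p t' (?B (int j - i)))
     else
       if odd i then tensor (?A i) (smap p t' (?B (int j - i)))
       else - (\<Sum>q=0..p-2. tensor (stail p t q (?A i))
                 (tpow t' (- (i div 2) + int q) (dmap t' (?B (int j - i))))))" for i
  have left: "coboundary (join K L) (?C j i) = U (i + 1) + V i" if i: "i \<in> {-1..int j}" for i
  proof -
    define b where "b = ?B (int j - i - 1)"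
    have i1: "i \<ge> -1" using i by simp
    have A: "?A i \<in> cochains K i" "stail p t q (?A i) \<in> cochains K i" for q
      using aug_cochains[OF K \<phi> i1] stail_cochains[OF K p0] by auto
    have B: "tpow t' k b \<in> cochains L (int j - i - 1)" for k
      unfolding b_def using i by (intro tpow_cochains[OF L p0] aug_cochains[OF L \<phi>']) simp
    note leibniz = coboundary_tensor[OF A(1) B i1] coboundary_tensor[OF A(2) B i1]
    have dA: "coboundary K (?A i) = (if odd i then smap p t (?A (i + 1)) else dmap t (?A (i + 1)))"
      by (rule coboundary_aug[OF \<phi> i1])
    have dB: "coboundary L b =
        (if odd (int j - i - 1) then smap p t' (?B (int j - i)) else dmap t' (?B (int j - i)))"
      using coboundary_aug[OF \<phi>', of "int j - i - 1"] i by (simp add: b_def)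
    \<comment> \<open>Apart from the shift by \<open>q\<close>, the exponent of \<open>t'\<close> in
      component \<open>i\<close> is \<open>- ((i + 1) div 2)\<close> in both parities, as in
      \<open>U (i + 1)\<close>.\<close>
    have half: "(i + 1) div 2 = (if odd i then i div 2 + 1 else i div 2)" by presburger
    have idx: "int j - (i + 1) = int j - i - 1" by simp
    show ?thesis
      unfolding join_component_aug[OF i1] U_def V_def half idx b_def[symmetric]
      by (simp add: leibniz coboundary_sum coboundary_stail[OF K p0] coboundary_tpow[OF L p0]
          dA dB tpow_smap[OF t(2) p0] sum_subtractf)
  qed
  have right: "(if even j then dmap ?T (?C (j + 1) i) else smap p ?T (?C (j + 1) i)) = U i + V i"
    if i: "i \<ge> -1" for i
  proof -
    have idx: "int (j + 1) - i - 1 = int j - i" by simp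
    \<comment> \<open>One identity for each pair of parities: \<open>dmap_tensor\<close> for
      \<open>j\<close> even and \<open>i\<close> odd, \<open>dmap_tensor_stail\<close> for both
      even, \<open>smap_tensor\<close> for \<open>j\<close> odd and \<open>i\<close> even,
      \<open>smap_tensor'\<close> for both odd.\<close>
    show ?thesis
      unfolding join_component_aug[OF i] U_def V_def idx
      using dmap_tensor[OF t p] dmap_tensor_stail[OF t p] smap_tensor[OF t p] smap_tensor'[OF t p]
      by simp
  qed
  have "coboundary (join K L) (join_resolution p t t' \<phi> \<phi>' j) = (\<Sum>i=-1..int j. U (i + 1) + V i)"
    unfolding join_resolution_def coboundary_sum by (rule sum.cong[OF refl left])
  also have "\<dots> = (\<Sum>i=-1..int j + 1. U i + V i)"
  proof (rule sum_shift_diagonal)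
    have "?A (-1) = empty_cochain" "?B (-1) = empty_cochain" by (simp_all add: aug_def)
    moreover have "stail p t q 0 = 0" for q
      by (simp add: stail_def smap_def spart_def tpow_zero)
    \<comment> \<open>As \<open>-1\<close> is odd and \<open>j + 1\<close> has the parity opposite
      to \<open>j\<close>, both terms fall into cases with \<open>d\<close>; a case with
      \<open>s\<close> would leave \<open>p\<close> times the empty cochain.\<close>
    ultimately show "U (-1) = 0" "V (int j + 1) = 0"
      by (simp_all add: U_def V_def tpow_zero)
  qed
  also have "\<dots> = (\<Sum>i=-1..int (j + 1). if even j then dmap ?T (?C (j + 1) i) else smap p ?T (?C (j + 1) i))"
    by (rule sum.cong) (simp_all only: right atLeastAtMost_iff, simp)
  also have "\<dots> = (if even j then dmap ?T (join_resolution p t t' \<phi> \<phi>' (j + 1))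
      else smap p ?T (join_resolution p t t' \<phi> \<phi>' (j + 1)))"
    unfolding join_resolution_def dmap_sum smap_sum by simp
  finally show ?thesis .
qed

text \<open>Since \<open>t\<close> fixes the empty cochain, applying \<open>s\<close> leaves the two
  terms of the Leibniz rule for the tensor square of the empty cochain, which is the empty cochain
  of the join.\<close>

lemma smap_join_resolution_0:
  assumes K: "Zp_complex p K t" and L: "Zp_complex p L t'" and p: "p \<ge> 2"
    and \<phi>: "resolution_of_one p K t \<phi>" and \<phi>': "resolution_of_one p L t' \<phi>'"
  shows "smap p (map_sum t t') (join_resolution p t t' \<phi> \<phi>' 0) = one_cochain (join K L)"
proof -
  have t: "t ^^ p = id" "t' ^^ p = id" using K L by (simp_all add: Zp_complex_def)
  have empty: "empty_cochain \<in> cochains K (-1)" "empty_cochain \<in> cochains L (-1)"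
    using aug_cochains[OF K \<phi>, of "-1"] aug_cochains[OF L \<phi>', of "-1"] by (simp_all add: aug_def)
  have "{-1..0::int} = {-1, 0}" by auto
  then have "join_resolution p t t' \<phi> \<phi>' 0 =
      tensor empty_cochain (\<phi>' 0) + tensor (\<phi> 0) empty_cochain"
    by (simp add: join_resolution_def join_component_def aug_def)
  then have "smap p (map_sum t t') (join_resolution p t t' \<phi> \<phi>' 0) =
      tensor empty_cochain (smap p t' (\<phi>' 0)) + tensor (smap p t (\<phi> 0)) empty_cochain"
    by (simp add: smap_add) (simp add: smap_def spart_def tpow_tensor[OF t p] tensor_sum_right tensor_sum_left)
  also have "\<dots> = tensor empty_cochain (one_cochain L) + tensor (one_cochain K) empty_cochain"
    using \<phi> \<phi>' by (simp add: resolution_of_one_def)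
  also have "\<dots> = coboundary (join K L) (tensor empty_cochain empty_cochain)"
    using coboundary_tensor[OF empty] by (simp add: coboundary_empty_cochain add.commute)
  also have "tensor empty_cochain empty_cochain = (empty_cochain :: ('a + 'b) list \<Rightarrow> int)"
  proof (rule ext)
    fix zs :: "('a + 'b) list"
    show "tensor empty_cochain empty_cochain zs = empty_cochain zs"
      using length_parts[of zs] by (cases zs) (auto simp: tensor_def empty_cochain_def)
  qed
  finally show ?thesis by (simp add: coboundary_empty_cochain)
qed

theorem proposition4:
  fixes p :: nat
    and K :: "'a set set" and t :: "'a \<Rightarrow> 'a"
    and L :: "'b set set" and t' :: "'b \<Rightarrow> 'b"
    and \<phi> :: "nat \<Rightarrow> 'a list \<Rightarrow> int" and \<phi>' :: "nat \<Rightarrow> 'b list \<Rightarrow> int"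
  assumes "prime p"
    and "Zp_complex p K t"
    and "Zp_complex p L t'"
    and "resolution_of_one p K t \<phi>"
    and "resolution_of_one p L t' \<phi>'"
  shows "resolution_of_one p (join K L) (map_sum t t') (join_resolution p t t' \<phi> \<phi>')"
proof -
  have p: "p \<ge> 2" using assms(1) by (rule prime_ge_2_nat)
  have "join_resolution p t t' \<phi> \<phi>' j \<in> cochains (join K L) (int j)" for j
    unfolding join_resolution_def
    using p by (intro cochains_sum join_component_cochains[OF assms(2,3) _ assms(4,5)]) auto
  then show ?thesis
    unfolding resolution_of_one_def
    using smap_join_resolution_0[OF assms(2,3) p assms(4,5)]
      coboundary_join_resolution[OF assms(2,3) p assms(4,5)] by simp
qed

end
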